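(* Let $G$ be a graph on $n$ vertices without isolated vertices. Then $\operatorname{pd}(G)\le n-\tau(G)$.
   Context: All graphs are finite and simple. For $X\subseteq V(G)$, $N(X)$ is the union of neighborhoods of vertices of $X$, and $\gamma_0(X,G)$ is the minimum cardinality of a set $A\subseteq V(G)$ with $X\subseteq N(A)$ (allowing $A\cap X\ne\emptyset$). $\tau(G)=\max\{\gamma_0(A,G):A\subseteq V(G)\text{ independent}\}$. For $G$ with vertex set $\{x_1,\dots,x_n\}$ and a fixed field $\mathbf{k}$, $S=\mathbf{k}[x_1,\dots,x_n]$, $I(G)$ is the edge ideal generated by $x_ix_j$ over edges $(x_i,x_j)$, and $\operatorname{pd}(G)$ is the projective dimension of $S/I(G)$. *)

theory Defs
  imports Main "HOL-Library.Poly_Mapping" "HOL-Library.Extended_Nat"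
begin

(* Polynomial ring S = k[x_v : v in V] with vertex type 'v (finite) and field 'k:
   polynomials are finitely supported maps from monomials (exponent vectors
   'v =>0 nat) to coefficients. *)
type_synonym ('v, 'k) mpoly = "('v \<Rightarrow>\<^sub>0 nat) \<Rightarrow>\<^sub>0 'k"

(* Simple graph on the vertex set UNIV :: 'v set: edges are 2-element sets. *)
definition simple_graph :: "'v set set \<Rightarrow> bool" where
  "simple_graph E \<longleftrightarrow> (\<forall>e\<in>E. \<exists>x y. x \<noteq> y \<and> e = {x, y})"

definition adj :: "'v set set \<Rightarrow> 'v \<Rightarrow> 'v \<Rightarrow> bool" where
  "adj E x y \<longleftrightarrow> {x, y} \<in> E \<and> x \<noteq> y"

definition no_isolated :: "'v set set \<Rightarrow> bool" where
  "no_isolated E \<longleftrightarrow> (\<forall>x. \<exists>y. adj E x y)"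

definition nbhd :: "'v set set \<Rightarrow> 'v set \<Rightarrow> 'v set" where
  "nbhd E X = {y. \<exists>x\<in>X. adj E x y}"

definition independent :: "'v set set \<Rightarrow> 'v set \<Rightarrow> bool" where
  "independent E A \<longleftrightarrow> (\<forall>x\<in>A. \<forall>y\<in>A. \<not> adj E x y)"

definition gamma0 :: "'v set set \<Rightarrow> 'v set \<Rightarrow> nat" where
  "gamma0 E X = Min {card A | A. finite A \<and> X \<subseteq> nbhd E A}"

definition tau :: "'v set set \<Rightarrow> nat" where
  "tau E = Max {gamma0 E A | A. independent E A}"

definition edge_monomial :: "'v set \<Rightarrow> ('v, 'k::field) mpoly" where
  "edge_monomial e = Poly_Mapping.single (\<Sum>w\<in>e. Poly_Mapping.single w 1) 1"

definition edge_ideal :: "'v set set \<Rightarrow> ('v, 'k::field) mpoly set" where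
  "edge_ideal E = {\<Sum>e\<in>E. c e * edge_monomial e | c. True}"

(* Free module S^a: vectors nat => S supported on {..<a} *)
definition fvecs :: "nat \<Rightarrow> (nat \<Rightarrow> 'r::comm_ring_1) set" where
  "fvecs a = {v. \<forall>j\<ge>a. v j = 0}"

definition mat_app :: "nat \<Rightarrow> nat \<Rightarrow> (nat \<Rightarrow> nat \<Rightarrow> 'r::comm_ring_1) \<Rightarrow> (nat \<Rightarrow> 'r) \<Rightarrow> (nat \<Rightarrow> 'r)" where
  "mat_app a b M v = (\<lambda>i. if i < b then (\<Sum>j<a. M i j * v j) else 0)"

definition mat_image :: "nat \<Rightarrow> nat \<Rightarrow> (nat \<Rightarrow> nat \<Rightarrow> 'r::comm_ring_1) \<Rightarrow> (nat \<Rightarrow> 'r) set" where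
  "mat_image a b M = mat_app a b M ` fvecs a"

definition mat_kernel :: "nat \<Rightarrow> nat \<Rightarrow> (nat \<Rightarrow> nat \<Rightarrow> 'r::comm_ring_1) \<Rightarrow> (nat \<Rightarrow> 'r) set" where
  "mat_kernel a b M = {v \<in> fvecs a. mat_app a b M v = (\<lambda>_. 0)}"

(* A finite free resolution of length p of S/I (I an ideal of S):
   0 -> S^{r p} --d p--> ... --d 2--> S^{r 1} --d 1--> S^{r 0} = S -> S/I -> 0,
   i.e. r 0 = 1, im d_1 = I (identifying S^1 with S), ker d_i = im d_{i+1}
   for 1 <= i <= p, where r (p+1) = 0 so that d_{p+1} = 0 (d_p injective). *)
definition free_resolution ::
  "'r::comm_ring_1 set \<Rightarrow> nat \<Rightarrow> (nat \<Rightarrow> nat) \<Rightarrow> (nat \<Rightarrow> nat \<Rightarrow> nat \<Rightarrow> 'r) \<Rightarrow> bool" where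
  "free_resolution I p r d \<longleftrightarrow>
     r 0 = 1 \<and> r (Suc p) = 0 \<and>
     (\<lambda>v. v 0) ` mat_image (r 1) (r 0) (d 1) = I \<and>
     (\<forall>i\<in>{1..p}. mat_kernel (r i) (r (i - 1)) (d i) = mat_image (r (Suc i)) (r i) (d (Suc i)))"

(* projective dimension of S/I: least length of a finite free resolution
   (infinity if none exists) *)
definition proj_dim_quot :: "'r::comm_ring_1 set \<Rightarrow> enat" where
  "proj_dim_quot I = Inf {enat p | p. \<exists>r d. free_resolution I p r d}"

definition pd_graph :: "'k::field itself \<Rightarrow> 'v set set \<Rightarrow> enat" where
  "pd_graph _ E = proj_dim_quot (edge_ideal E :: ('v, 'k::field) mpoly set)"

end

theory Submission
  imports Defs "HOL-Library.Function_Algebras"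
begin

text \<open>
  Splitting the squarefree monomial ideal \<open>I\<close> along a variable \<open>x\<close> gives a short exact sequence
  \<open>0 \<rightarrow> J \<rightarrow> (I : x) \<oplus> J \<rightarrow> I \<rightarrow> 0\<close>, where \<open>J\<close> is generated by the elements of \<open>I\<close> free of \<open>x\<close>; hence
  \<open>pd (S/I) \<le> max (pd (S/(I : x))) (pd (S/J) + 1)\<close>. For an edge ideal, \<open>J\<close> belongs to \<open>G - x\<close> and \<open>I : x\<close>
  to \<open>G - N[x]\<close> together with the variables in \<open>N(x)\<close>. Fix an independent set \<open>A\<close> with
  \<open>\<gamma>\<^sub>0(A, G) = \<tau>(G)\<close> and always split along a non-isolated \<open>x \<notin> A\<close>. Deletions create isolated vertices,
  so domination is relaxed to let an isolated vertex dominate itself. With this convention the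
  domination number of the remaining part of \<open>A\<close> does not drop from \<open>G\<close> to \<open>G - x\<close> and drops by at most
  one from \<open>G\<close> to \<open>G - N[x]\<close> (put back \<open>x\<close>, and replace each self-dominating vertex by one of its
  former neighbours), and the bound follows by induction on the number of vertices.
\<close>

section \<open>Submodules of free modules, linear maps and bounded resolutions\<close>

definition smul :: "'r::comm_ring_1 \<Rightarrow> (nat \<Rightarrow> 'r) \<Rightarrow> nat \<Rightarrow> 'r" where
  "smul c v = (\<lambda>i. c * v i)"

definition submod :: "(nat \<Rightarrow> 'r::comm_ring_1) set \<Rightarrow> bool" where
  "submod M \<longleftrightarrow> 0 \<in> M \<and> (\<forall>u\<in>M. \<forall>v\<in>M. u + v \<in> M) \<and> (\<forall>c. \<forall>u\<in>M. smul c u \<in> M)"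

text \<open>Maps are total functions, so linearity is demanded only on \<open>M\<close>. This admits
  maps such as the inverse of an injection, which are meaningful only on a submodule.\<close>

definition linear_on ::
  "(nat \<Rightarrow> 'r::comm_ring_1) set \<Rightarrow> ((nat \<Rightarrow> 'r) \<Rightarrow> nat \<Rightarrow> 'r) \<Rightarrow> bool" where
  "linear_on M f \<longleftrightarrow> (\<forall>u\<in>M. \<forall>v\<in>M. f (u + v) = f u + f v) \<and>
     (\<forall>c. \<forall>u\<in>M. f (smul c u) = smul c (f u))"

definition unit_vec :: "nat \<Rightarrow> nat \<Rightarrow> 'r::comm_ring_1" where
  "unit_vec j = (\<lambda>i. if i = j then 1 else 0)"

definition vec_take :: "nat \<Rightarrow> (nat \<Rightarrow> 'r::comm_ring_1) \<Rightarrow> nat \<Rightarrow> 'r" where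
  "vec_take b u = (\<lambda>i. if i < b then u i else 0)"

definition vec_drop :: "nat \<Rightarrow> (nat \<Rightarrow> 'r::comm_ring_1) \<Rightarrow> nat \<Rightarrow> 'r" where
  "vec_drop b u = (\<lambda>i. u (i + b))"

definition vec_append :: "nat \<Rightarrow> (nat \<Rightarrow> 'r::comm_ring_1) \<Rightarrow> (nat \<Rightarrow> 'r) \<Rightarrow> nat \<Rightarrow> 'r" where
  "vec_append b v w = (\<lambda>i. if i < b then v i else w (i - b))"

text \<open>\<open>has_res p M\<close> says that the module \<open>M\<close> has projective dimension less than \<open>p\<close>;
  with the shift, an ideal \<open>I\<close> satisfies it iff \<open>pd (S/I) \<le> p\<close>.\<close>

fun has_res :: "nat \<Rightarrow> (nat \<Rightarrow> 'r::comm_ring_1) set \<Rightarrow> bool" where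
  "has_res 0 M \<longleftrightarrow> M = {0}"
| "has_res (Suc p) M \<longleftrightarrow>
     (\<exists>b L. linear_on (fvecs b) L \<and> L ` fvecs b = M \<and> has_res p {v \<in> fvecs b. L v = 0})"

lemma smul_simps [simp]:
  "smul c u i = c * u i" "smul 0 u = 0" "smul c 0 = 0" "smul 1 u = u"
  by (auto simp: smul_def fun_eq_iff)

lemma smul_add: "smul c (u + v) = smul c u + smul c v"
  by (simp add: fun_eq_iff algebra_simps)

lemma diff_conv_smul: "u - v = u + smul (-1) v"
  by (simp add: fun_eq_iff)

lemma sum_fun_apply: "(\<Sum>j\<in>S. u j) i = (\<Sum>j\<in>S. u j i)"
  by (induction S rule: infinite_finite_induct) auto

lemma submodD:
  assumes "submod M"
  shows "0 \<in> M" "u \<in> M \<Longrightarrow> v \<in> M \<Longrightarrow> u + v \<in> M" "u \<in> M \<Longrightarrow> smul c u \<in> M"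
    "u \<in> M \<Longrightarrow> v \<in> M \<Longrightarrow> u - v \<in> M"
  using assms unfolding submod_def diff_conv_smul by blast+

lemma submod_sum: "submod M \<Longrightarrow> (\<And>j. j \<in> S \<Longrightarrow> u j \<in> M) \<Longrightarrow> (\<Sum>j\<in>S. u j) \<in> M"
  by (induction S rule: infinite_finite_induct) (auto intro: submodD)

lemma linear_onD:
  assumes "linear_on M f"
  shows "u \<in> M \<Longrightarrow> v \<in> M \<Longrightarrow> f (u + v) = f u + f v" "u \<in> M \<Longrightarrow> f (smul c u) = smul c (f u)"
  using assms unfolding linear_on_def by blast+

lemma linear_on_0: "linear_on M f \<Longrightarrow> submod M \<Longrightarrow> f 0 = 0"
  using linear_onD(2)[of M f 0 0] submodD(1)[of M] by simp

lemma linear_on_diff: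
  "linear_on M f \<Longrightarrow> submod M \<Longrightarrow> u \<in> M \<Longrightarrow> v \<in> M \<Longrightarrow> f (u - v) = f u - f v"
  using linear_onD(1)[of M f u "smul (-1) v"] linear_onD(2)[of M f v "-1"] submodD(3)[of M v "-1"]
  by (simp only: diff_conv_smul)

lemma linear_on_sum:
  assumes "linear_on M f" "submod M" "\<And>j. j \<in> S \<Longrightarrow> u j \<in> M"
  shows "f (\<Sum>j\<in>S. u j) = (\<Sum>j\<in>S. f (u j))"
  using assms(3)
  by (induction S rule: infinite_finite_induct)
    (simp_all add: linear_on_0[OF assms(1,2)] linear_onD[OF assms(1)] submod_sum[OF assms(2)])

lemma submod_fvecs: "submod (fvecs b)"
  by (auto simp: submod_def fvecs_def)

lemma submod_image:
  assumes "submod M" "linear_on M f"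
  shows "submod (f ` M)"
  unfolding submod_def
proof (intro conjI ballI allI)
  show "0 \<in> f ` M" using linear_on_0[OF assms(2,1)] submodD(1)[OF assms(1)] by (metis imageI)
next
  fix x y assume "x \<in> f ` M" "y \<in> f ` M"
  then obtain u v where "u \<in> M" "v \<in> M" "x = f u" "y = f v" by blast
  then show "x + y \<in> f ` M"
    using linear_onD(1)[OF assms(2), of u v] submodD(2)[OF assms(1), of u v] by (metis imageI)
next
  fix c x assume "x \<in> f ` M"
  then obtain u where "u \<in> M" "x = f u" by blast
  then show "smul c x \<in> f ` M"
    using linear_onD(2)[OF assms(2), of u c] submodD(3)[OF assms(1), of u c] by (metis imageI)
qed

lemma submod_kernel:
  assumes "submod M" "linear_on M f"
  shows "submod {v \<in> M. f v = 0}"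
  unfolding submod_def
  by (simp add: linear_onD[OF assms(2)] submodD[OF assms(1)] linear_on_0[OF assms(2,1)])

lemma submod_zero: "submod {0}"
  by (simp add: submod_def)

lemma has_res_submod: "has_res p M \<Longrightarrow> submod M"
  by (cases p) (auto simp: submod_zero submod_fvecs submod_image)

lemma unit_vec_in_fvecs: "j < b \<Longrightarrow> unit_vec j \<in> fvecs b"
  by (auto simp: fvecs_def unit_vec_def)

lemma linear_on_fvecs_expand:
  assumes "linear_on (fvecs b) L" "w \<in> fvecs b"
  shows "L w = (\<Sum>j<b. smul (w j) (L (unit_vec j)))"
proof -
  have w: "w = (\<Sum>j<b. smul (w j) (unit_vec j))"
  proof
    fix i
    have "w i = (if i < b then w i else 0)" using assms(2) by (auto simp: fvecs_def)
    then show "w i = (\<Sum>j<b. smul (w j) (unit_vec j)) i"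
      by (simp add: sum_fun_apply unit_vec_def if_distrib cong: if_cong)
  qed
  have "L w = (\<Sum>j<b. L (smul (w j) (unit_vec j)))"
    by (subst w, rule linear_on_sum[OF assms(1) submod_fvecs])
       (auto intro: submodD submod_fvecs unit_vec_in_fvecs)
  also have "\<dots> = (\<Sum>j<b. smul (w j) (L (unit_vec j)))"
    by (intro sum.cong) (auto simp: linear_onD[OF assms(1)] unit_vec_in_fvecs)
  finally show ?thesis .
qed

lemma fvecs_0: "fvecs 0 = {0}"
  by (auto simp: fvecs_def fun_eq_iff)

text \<open>The zero module is the image of the free module of rank 0, so a resolution can be padded
  at its end.\<close>

lemma has_res_Suc: "has_res p M \<Longrightarrow> has_res (Suc p) M"
proof (induction p arbitrary: M)
  case 0
  then show ?case
    by (auto simp: fvecs_0 linear_on_def intro!: exI[of _ 0] exI[of _ "\<lambda>x. x"])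
next
  case (Suc p)
  from Suc.prems obtain b L where "linear_on (fvecs b) L" "L ` fvecs b = M"
    "has_res p {v \<in> fvecs b. L v = 0}" by auto
  then show ?case
    by (subst has_res.simps(2), intro exI[of _ b] exI[of _ L] conjI Suc.IH)
qed

lemma has_res_mono: "has_res p M \<Longrightarrow> p \<le> q \<Longrightarrow> has_res q M"
  by (rotate_tac, induction q rule: dec_induct) (simp_all only: has_res_Suc)

section \<open>Block vectors and short exact sequences\<close>

lemma vec_linear:
  "vec_take b (u + v) = vec_take b u + vec_take b v"
  "vec_take b (smul c u) = smul c (vec_take b u)"
  "vec_drop b (u + v) = vec_drop b u + vec_drop b v"
  "vec_drop b (smul c u) = smul c (vec_drop b u)"
  by (auto simp: vec_take_def vec_drop_def fun_eq_iff)

lemma vec_mem: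
  "vec_take b u \<in> fvecs b"
  "u \<in> fvecs (b + c) \<Longrightarrow> vec_drop b u \<in> fvecs c"
  "w \<in> fvecs c \<Longrightarrow> vec_append b v w \<in> fvecs (b + c)"
  by (auto simp: fvecs_def vec_take_def vec_drop_def vec_append_def)

lemma vec_append_simps [simp]:
  "v \<in> fvecs b \<Longrightarrow> vec_take b (vec_append b v w) = v"
  "vec_drop b (vec_append b v w) = w"
  by (auto simp: fvecs_def vec_take_def vec_drop_def vec_append_def fun_eq_iff)

text \<open>The horseshoe lemma: lifting the generators of \<open>M''\<close> to \<open>M\<close> produces a short exact
  sequence of first syzygies of the same shape, on which one recurses.\<close>

lemma has_res_extension:
  assumes "has_res p M'" "has_res p M''" "submod M" "linear_on M' f"
    "inj_on f M'" "f ` M' = {m \<in> M. g m = 0}" "linear_on M g" "g ` M = M''"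
  shows "has_res p M"
  using assms
proof (induction p arbitrary: M' M M'' f g)
  case 0
  have "M' = {0}" using "0.prems"(1) by simp
  moreover from this have "f 0 = 0" using linear_on_0[OF "0.prems"(4)] submod_zero by blast
  ultimately have "{m \<in> M. g m = 0} = {0}"
    unfolding "0.prems"(6)[symmetric] by (simp only: image_insert image_empty)
  moreover have "g m = 0" if "m \<in> M" for m using "0.prems"(2,8) that by auto
  ultimately show ?case unfolding has_res.simps by blast
next
  case (Suc p)
  note M = \<open>submod M\<close> and f = \<open>linear_on M' f\<close> and g = \<open>linear_on M g\<close>
  note ker_g = \<open>f ` M' = {m \<in> M. g m = 0}\<close>
  have M': "submod M'" using Suc.prems(1) has_res_submod by blast
  obtain b L' where L': "linear_on (fvecs b) L'" "L' ` fvecs b = M'" and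
    K': "has_res p {v \<in> fvecs b. L' v = 0}" using Suc.prems(1) by auto
  obtain c L'' where L'': "linear_on (fvecs c) L''" "L'' ` fvecs c = M''" and
    K'': "has_res p {v \<in> fvecs c. L'' v = 0}" using Suc.prems(2) by auto
  have "\<forall>j. \<exists>m. j < c \<longrightarrow> m \<in> M \<and> g m = L'' (unit_vec j)"
    using L''(2) \<open>g ` M = M''\<close> unit_vec_in_fvecs[of _ c] by (metis imageE imageI)
  then obtain m where m: "\<And>j. j < c \<Longrightarrow> m j \<in> M" "\<And>j. j < c \<Longrightarrow> g (m j) = L'' (unit_vec j)"
    by metis
  \<comment> \<open>Preimages of the images of the basis vectors extend linearly, by freeness, to a
    lift of \<open>L''\<close> through \<open>g\<close>.\<close>
  define lift where "lift w = (\<Sum>j<c. smul (w j) (m j))" for w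
  have lift_M: "lift w \<in> M" for w
    unfolding lift_def by (intro submod_sum M submodD) (auto simp: m)
  have lift_add: "lift (v + w) = lift v + lift w" and lift_smul: "lift (smul k w) = smul k (lift w)"
    for v w k
    by (auto simp: lift_def fun_eq_iff sum_fun_apply sum.distrib sum_distrib_left algebra_simps)
  have g_lift: "g (lift w) = L'' w" if "w \<in> fvecs c" for w
  proof -
    have "g (lift w) = (\<Sum>j<c. g (smul (w j) (m j)))"
      unfolding lift_def by (rule linear_on_sum[OF g M]) (auto intro: submodD M m)
    also have "\<dots> = (\<Sum>j<c. smul (w j) (L'' (unit_vec j)))"
      by (intro sum.cong) (auto simp: linear_onD[OF g] m)
    also have "\<dots> = L'' w" using linear_on_fvecs_expand[OF L''(1) that] by simp
    finally show ?thesis .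
  qed
  have L'_M: "L' (vec_take b u) \<in> M'" for u using L'(2) vec_mem(1) by blast
  \<comment> \<open>The middle cover of the horseshoe: the first \<open>b\<close> coordinates go
    through \<open>L'\<close> and \<open>f\<close>, the remaining \<open>c\<close> are
    lifted.\<close>
  define L where "L u = f (L' (vec_take b u)) + lift (vec_drop b u)" for u
  have linL: "linear_on (fvecs (b + c)) L"
    unfolding linear_on_def L_def
    by (auto simp: vec_linear linear_onD[OF L'(1)] vec_mem linear_onD[OF f] L'_M lift_add lift_smul
        smul_add)
  have f_M: "f v \<in> M" "g (f v) = 0" if "v \<in> M'" for v using ker_g that by blast+
  have gL: "g (L u) = L'' (vec_drop b u)" if "u \<in> fvecs (b + c)" for u
    unfolding L_def using that
    by (simp add: linear_onD[OF g] f_M L'_M lift_M g_lift vec_mem)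
  have lift_0: "lift 0 = 0" by (simp add: lift_def)
  have "L ` fvecs (b + c) = M"
  proof (intro equalityI subsetI)
    fix x assume "x \<in> L ` fvecs (b + c)"
    then show "x \<in> M" by (auto simp: L_def intro: submodD M f_M L'_M lift_M)
  next
    fix x assume x: "x \<in> M"
    then obtain w where w: "w \<in> fvecs c" "g x = L'' w" using L''(2) \<open>g ` M = M''\<close> by blast
    have "g (x - lift w) = 0" by (simp add: linear_on_diff[OF g M] x lift_M g_lift w)
    then obtain v where v: "v \<in> M'" "x - lift w = f v"
      using ker_g submodD(4)[OF M x lift_M] by blast
    then obtain y where y: "y \<in> fvecs b" "v = L' y" using L'(2) by blast
    have "L (vec_append b y w) = f v + lift w" by (simp add: L_def y)
    also have "\<dots> = x" unfolding v(2)[symmetric] by (rule diff_add_cancel)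
    finally show "x \<in> L ` fvecs (b + c)"
      by (intro rev_image_eqI[OF vec_mem(3)[OF w(1)]]) (rule sym)
  qed
  moreover have "has_res p {v \<in> fvecs (b + c). L v = 0}" (is "has_res p ?K")
  \<comment> \<open>The kernels of \<open>L'\<close>, \<open>L\<close> and \<open>L''\<close> again
    form a short exact sequence, now with the inclusion and the projection to the last block as its
    maps.\<close>
  proof (rule Suc.IH[OF K' K'', where f = "\<lambda>v. v" and g = "vec_drop b"])
    show "submod ?K" by (rule submod_kernel[OF submod_fvecs linL])
    show "linear_on ?K (vec_drop b)" by (auto simp: linear_on_def vec_linear)
    have take: "vec_take b v = v" and drop: "vec_drop b v = 0" if "v \<in> fvecs b" for v :: "nat \<Rightarrow> 'a"
      using that by (auto simp: fvecs_def vec_take_def vec_drop_def fun_eq_iff)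
    show "(\<lambda>v. v) ` {v \<in> fvecs b. L' v = 0} = {m \<in> ?K. vec_drop b m = 0}"
    proof (intro equalityI subsetI)
      fix v assume "v \<in> (\<lambda>v. v) ` {v \<in> fvecs b. L' v = 0}"
      then have "v \<in> fvecs b" "L' v = 0" by auto
      moreover from this have "v \<in> fvecs (b + c)" by (auto simp: fvecs_def)
      ultimately show "v \<in> {m \<in> ?K. vec_drop b m = 0}"
        by (simp add: L_def take drop lift_0 linear_on_0[OF f M'])
    next
      fix v assume v: "v \<in> {m \<in> ?K. vec_drop b m = 0}"
      have "v i = 0" if "i \<ge> b" for i
      proof -
        have "vec_drop b v (i - b) = 0" using v by simp
        then show ?thesis using that by (simp add: vec_drop_def)
      qed
      then have vb: "v \<in> fvecs b" by (simp add: fvecs_def)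
      then have "f (L' v) = 0" using v by (simp add: L_def take drop lift_0)
      then have "f (L' v) = f 0" by (simp only: linear_on_0[OF f M'])
      then have "L' v = 0"
        using inj_onD[OF Suc.prems(5)] L'(2) vb submodD(1)[OF M'] by blast
      then show "v \<in> (\<lambda>v. v) ` {v \<in> fvecs b. L' v = 0}" using vb by simp
    qed
    show "vec_drop b ` ?K = {v \<in> fvecs c. L'' v = 0}"
    proof (intro equalityI subsetI)
      fix w assume "w \<in> vec_drop b ` ?K"
      then obtain u where u: "u \<in> fvecs (b + c)" "L u = 0" "w = vec_drop b u" by blast
      then show "w \<in> {v \<in> fvecs c. L'' v = 0}"
        using gL[OF u(1)] by (simp add: vec_mem linear_on_0[OF g M])
    next
      fix w assume w: "w \<in> {v \<in> fvecs c. L'' v = 0}"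
      \<comment> \<open>Since \<open>w\<close> is a syzygy of \<open>M''\<close>, its lift lies in
        the kernel of \<open>g\<close> and hence comes from some \<open>L' y\<close>. Putting
        \<open>-y\<close> in the first block cancels it.\<close>
      then have "lift w \<in> f ` M'" using ker_g lift_M g_lift by auto
      then obtain y where y: "y \<in> fvecs b" "lift w = f (L' y)" using L'(2) by blast
      have neg: "smul (-1) y \<in> fvecs b" using y(1) submodD(3)[OF submod_fvecs] by blast
      have "L (vec_append b (smul (-1) y) w) = smul (-1) (f (L' y)) + f (L' y)"
        using neg y L'(2) by (auto simp: L_def linear_onD[OF L'(1)] linear_onD[OF f])
      also have "\<dots> = 0" by (simp add: fun_eq_iff)
      finally have "vec_append b (smul (-1) y) w \<in> ?K" using vec_mem(3) w by auto
      then show "w \<in> vec_drop b ` ?K" by (rule rev_image_eqI) simp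
    qed
  qed (auto simp: linear_on_def)
  ultimately show ?case using linL by auto
qed

text \<open>A free cover \<open>L\<close> of \<open>M\<close>, followed by \<open>g\<close>, covers
  \<open>M''\<close>. Its kernel is an extension of \<open>M'\<close> by the kernel of
  \<open>L\<close>, and both have resolutions of length \<open>p\<close>. In usual terms, pd
  \<open>M''\<close> \<le> max (pd \<open>M\<close>) (pd \<open>M'\<close> + 1).\<close>

lemma has_res_cokernel:
  assumes M': "has_res p M'" and resM: "has_res (Suc p) M" and f: "linear_on M' f"
    and inj: "inj_on f M'" and ker_g: "f ` M' = {m \<in> M. g m = 0}"
    and g: "linear_on M g" and im_g: "g ` M = M''"
  shows "has_res (Suc p) M''"
proof -
  have sM: "submod M" and sM': "submod M'" using has_res_submod M' resM by blast+
  obtain b L where L: "linear_on (fvecs b) L" "L ` fvecs b = M" and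
    K: "has_res p {v \<in> fvecs b. L v = 0}" using resM by auto
  have L_M: "L v \<in> M" if "v \<in> fvecs b" for v using L(2) that by blast
  \<comment> \<open>\<open>L\<close> sends the kernel of the composite cover into the image of
    \<open>f\<close>. Undoing \<open>f\<close> there gives a surjection onto \<open>M'\<close> whose
    kernel is that of \<open>L\<close>.\<close>
  define h where "h = inv_into M' f"
  have hf: "h (f y) = y" if "y \<in> M'" for y
    unfolding h_def using that inj by (rule inv_into_f_f[rotated])
  have gL: "linear_on (fvecs b) (\<lambda>v. g (L v))"
    unfolding linear_on_def by (auto simp: linear_onD[OF L(1)] linear_onD[OF g] L_M)
  let ?K = "{v \<in> fvecs b. g (L v) = 0}"
  have LK: "\<exists>y\<in>M'. L v = f y" if "v \<in> ?K" for v
    using that ker_g L_M by blast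
  have "has_res p ?K"
  proof (rule has_res_extension[OF K M', where f = "\<lambda>v. v" and g = "\<lambda>v. h (L v)"])
    show "submod ?K" by (rule submod_kernel[OF submod_fvecs gL])
    have "h (L (u + v)) = h (L u) + h (L v)" if uv: "u \<in> ?K" "v \<in> ?K" for u v
    proof -
      obtain y z where yz: "y \<in> M'" "z \<in> M'" "L u = f y" "L v = f z"
        using LK[OF uv(1)] LK[OF uv(2)] by blast
      then have "L (u + v) = f (y + z)" using uv by (simp add: linear_onD[OF L(1)] linear_onD[OF f])
      then show ?thesis using yz by (simp add: hf submodD[OF sM'])
    qed
    moreover have "h (L (smul c u)) = smul c (h (L u))" if u: "u \<in> ?K" for c u
    proof -
      obtain y where y: "y \<in> M'" "L u = f y" using LK[OF u] by blast
      then have "L (smul c u) = f (smul c y)" using u by (simp add: linear_onD[OF L(1)] linear_onD[OF f])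
      then show ?thesis using y by (simp add: hf submodD[OF sM'])
    qed
    ultimately show "linear_on ?K (\<lambda>v. h (L v))" unfolding linear_on_def by blast
    have "h (L v) = 0 \<longleftrightarrow> L v = 0" if "v \<in> ?K" for v
      using LK[OF that] hf linear_on_0[OF f sM'] submodD(1)[OF sM'] by metis
    moreover have "g 0 = 0" by (rule linear_on_0[OF g sM])
    moreover have "h 0 = 0" using hf[OF submodD(1)[OF sM']] linear_on_0[OF f sM'] by simp
    ultimately show "(\<lambda>v. v) ` {v \<in> fvecs b. L v = 0} = {m \<in> ?K. h (L m) = 0}" by auto
    show "(\<lambda>v. h (L v)) ` ?K = M'"
    proof (intro equalityI subsetI)
      fix y assume "y \<in> (\<lambda>v. h (L v)) ` ?K"
      then show "y \<in> M'" using LK hf by fastforce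
    next
      fix y assume y: "y \<in> M'"
      then have "f y \<in> M" and gfy: "g (f y) = 0" using ker_g by blast+
      then have "f y \<in> L ` fvecs b" by (simp only: L(2))
      then obtain v where "v \<in> fvecs b" "L v = f y" by (elim imageE) simp
      with gfy show "y \<in> (\<lambda>v. h (L v)) ` ?K"
        using hf[OF y] by (intro image_eqI[of _ _ v]) auto
    qed
  qed (auto simp: linear_on_def)
  moreover have "(\<lambda>v. g (L v)) ` fvecs b = M''" using L(2) im_g by (simp add: image_image[symmetric])
  ultimately show ?thesis using gL by auto
qed

section \<open>From iterated syzygies to matrices\<close>

text \<open>The recursion of \<open>has_res\<close> is unrolled, each cover becoming a matrix. The
  rank \<open>a\<close> is general because the next module, a kernel, lies in the free module that
  covers the current one.\<close>

lemma has_res_free_resolution: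
  fixes M :: "(nat \<Rightarrow> 'r::comm_ring_1) set"
  assumes "has_res p M" "M \<subseteq> fvecs a"
  shows "\<exists>r d. r 0 = a \<and> r (Suc p) = 0 \<and> mat_image (r 1) (r 0) (d 1) = M \<and>
    (\<forall>i\<in>{1..p}. mat_kernel (r i) (r (i - 1)) (d i) = mat_image (r (Suc i)) (r i) (d (Suc i)))"
  using assms
proof (induction p arbitrary: M a)
  case 0
  have "mat_image 0 a (\<lambda>_ _. 0) = M"
    using 0 by (auto simp: mat_image_def fvecs_0 mat_app_def fun_eq_iff)
  then show ?case
    by (intro exI[of _ "\<lambda>i. if i = 0 then a else 0"] exI[of _ "\<lambda>_ _ _. 0"]) auto
next
  case (Suc p)
  obtain b L where L: "linear_on (fvecs b) L" "L ` fvecs b = M" and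
    K: "has_res p {v \<in> fvecs b. L v = 0}" (is "has_res p ?K") using Suc.prems by auto
  obtain r d where rd: "r 0 = b" "r (Suc p) = 0" "mat_image (r 1) (r 0) (d 1) = ?K"
    "\<forall>i\<in>{1..p}. mat_kernel (r i) (r (i - 1)) (d i) = mat_image (r (Suc i)) (r i) (d (Suc i))"
    using Suc.IH[OF K, of b] by blast
  define D where "D i j = L (unit_vec j) i" for i j
  have D: "mat_app b a D v = L v" if v: "v \<in> fvecs b" for v
  proof
    fix i
    have "L v \<in> fvecs a" using Suc.prems(2) L(2) v by blast
    then have "\<not> i < a \<Longrightarrow> L v i = 0" by (simp add: fvecs_def)
    then show "mat_app b a D v i = L v i"
      using fun_cong[OF linear_on_fvecs_expand[OF L(1) v], of i]
      by (simp add: mat_app_def D_def sum_fun_apply mult.commute)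
  qed
  \<comment> \<open>The resolution of the kernel moves up by one place, with \<open>a\<close> and
    \<open>D\<close> put in front.\<close>
  define r' where "r' i = (case i of 0 \<Rightarrow> a | Suc j \<Rightarrow> r j)" for i
  define d' where "d' i = (if i = 1 then D else d (i - 1))" for i
  have im: "mat_image b a D = M" using L(2) D by (auto simp: mat_image_def)
  have ker: "mat_kernel b a D = ?K" using D by (auto simp: mat_kernel_def zero_fun_def)
  have "mat_kernel (r' i) (r' (i - 1)) (d' i) = mat_image (r' (Suc i)) (r' i) (d' (Suc i))"
    if i: "i \<in> {1..Suc p}" for i
  proof (cases "i = 1")
    case True
    then show ?thesis using ker rd by (simp add: r'_def d'_def)
  next
    case False
    then obtain k where "i = Suc (Suc k)" "Suc k \<in> {1..p}" using i
      by (metis One_nat_def Suc_le_mono atLeastAtMost_iff le_add1 not0_implies_Suc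
          not_one_le_zero plus_1_eq_Suc)
    then show ?thesis using bspec[OF rd(4), of "Suc k"] by (simp add: r'_def d'_def)
  qed
  then show ?case using im rd
    by (intro exI[of _ r'] exI[of _ d']) (auto simp: r'_def d'_def)
qed

section \<open>Squarefree monomial ideals and splitting along a variable\<close>

text \<open>Only the support of a monomial is tested. For \<open>F\<close> closed under supersets
  this is a squarefree monomial ideal, and ideal operations become set operations on
  \<open>F\<close>.\<close>

definition sf_ideal :: "'v set set \<Rightarrow> ('v, 'k::field) mpoly set" where
  "sf_ideal F = {p. \<forall>t\<in>Poly_Mapping.keys p. Poly_Mapping.keys t \<in> F}"

definition upclosed :: "'v set set \<Rightarrow> bool" where
  "upclosed F \<longleftrightarrow> (\<forall>s\<in>F. \<forall>t. s \<subseteq> t \<longrightarrow> t \<in> F)"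

text \<open>Places the ring in the free module of rank one, so that ideals become sets of vectors as
  \<open>has_res\<close> expects.\<close>

definition vec1 :: "'r::comm_ring_1 \<Rightarrow> nat \<Rightarrow> 'r" where
  "vec1 p = (\<lambda>i. if i = 0 then p else 0)"

lemma keys_plus_nat:
  fixes s t :: "'v \<Rightarrow>\<^sub>0 nat"
  shows "Poly_Mapping.keys (s + t) = Poly_Mapping.keys s \<union> Poly_Mapping.keys t"
  by (auto simp: in_keys_iff lookup_add)

lemma sf_ideal_zero: "0 \<in> sf_ideal F"
  by (simp add: sf_ideal_def)

lemma sf_ideal_add: "p \<in> sf_ideal F \<Longrightarrow> q \<in> sf_ideal F \<Longrightarrow> p + q \<in> sf_ideal F"
  using Poly_Mapping.keys_add[of p q] by (auto simp: sf_ideal_def)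

lemma sf_ideal_uminus: "p \<in> sf_ideal F \<Longrightarrow> - p \<in> sf_ideal F"
  by (auto simp: sf_ideal_def in_keys_iff)

lemma sf_ideal_diff: "p \<in> sf_ideal F \<Longrightarrow> q \<in> sf_ideal F \<Longrightarrow> p - q \<in> sf_ideal F"
  using sf_ideal_add[of p F "- q"] sf_ideal_uminus[of q F] by simp

lemma sf_ideal_mult:
  assumes "upclosed F" "p \<in> sf_ideal F"
  shows "q * p \<in> sf_ideal F"
proof -
  have "Poly_Mapping.keys t \<in> F" if t: "t \<in> Poly_Mapping.keys (q * p)" for t
  proof -
    obtain a b where ab: "t = a + b" "b \<in> Poly_Mapping.keys p"
      using Poly_Mapping.keys_mult[of q p] t by blast
    then have "Poly_Mapping.keys b \<in> F" using assms(2) by (simp add: sf_ideal_def)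
    then show ?thesis using assms(1) ab(1) keys_plus_nat[of a b] unfolding upclosed_def by blast
  qed
  then show ?thesis by (simp add: sf_ideal_def)
qed

lemma sf_ideal_sum: "(\<And>e. e \<in> S \<Longrightarrow> p e \<in> sf_ideal F) \<Longrightarrow> (\<Sum>e\<in>S. p e) \<in> sf_ideal F"
  by (induction S rule: infinite_finite_induct) (auto simp: sf_ideal_zero sf_ideal_add)

text \<open>A polynomial is the sum of its terms, and each term of a member is again a member, so
  additive properties need checking only on terms.\<close>

lemma sf_ideal_induct [consumes 1, case_names zero add monomial]:
  assumes "p \<in> sf_ideal F" "P 0" "\<And>a b. P a \<Longrightarrow> P b \<Longrightarrow> P (a + b)"
    "\<And>t c. Poly_Mapping.keys t \<in> F \<Longrightarrow> P (Poly_Mapping.single t c)"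
  shows "P p"
proof -
  have p: "p = (\<Sum>t\<in>Poly_Mapping.keys p. Poly_Mapping.single t (Poly_Mapping.lookup p t))"
    by (rule poly_mapping_eqI)
      (simp add: lookup_sum lookup_single when_def in_keys_iff)
  have "P (\<Sum>t\<in>S. Poly_Mapping.single t (Poly_Mapping.lookup p t))"
    if "finite S" "S \<subseteq> Poly_Mapping.keys p" for S
    using that
  proof (induction S rule: finite_induct)
    case empty
    show ?case using assms(2) by simp
  next
    case (insert t S)
    have "Poly_Mapping.keys t \<in> F" using insert.prems assms(1) by (auto simp: sf_ideal_def)
    then show ?case using insert assms(3,4) by simp
  qed
  from this[of "Poly_Mapping.keys p"] show ?thesis by (simp flip: p)
qed

lemma lookup_monomial_mult:
  fixes q :: "('v, 'k::field) mpoly"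
  shows "Poly_Mapping.lookup (Poly_Mapping.single a c * q) (a + t) = c * Poly_Mapping.lookup q t"
  by (simp add: lookup_mult lookup_single when_mult)

lemma vec1_simps [simp]: "vec1 p 0 = p" "i > 0 \<Longrightarrow> vec1 p i = 0" "vec1 p = vec1 q \<longleftrightarrow> p = q"
  by (auto simp: vec1_def fun_eq_iff)

lemma vec1_image_iff: "v \<in> vec1 ` I \<longleftrightarrow> v 0 \<in> I \<and> (\<forall>i>0. v i = 0)"
  by (auto simp: vec1_def fun_eq_iff image_iff)

text \<open>With \<open>J\<close> and \<open>Q\<close> denoting the ideals of the two hypotheses, \<open>Q\<close> is the colon ideal of
  \<open>I = sf_ideal F\<close> by the variable \<open>x\<close>, and \<open>J\<close> is spanned by the monomials that stay in \<open>I\<close> after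
  setting \<open>x = 1\<close>. The resolution comes from the short exact sequence
  \<open>0 \<rightarrow> J \<rightarrow> Q \<oplus> J \<rightarrow> I \<rightarrow> 0\<close> with maps \<open>u \<mapsto> (u, x u)\<close> and \<open>(q, j) \<mapsto> x q - j\<close>.\<close>

lemma has_res_sf_ideal_split:
  fixes x :: 'v
  assumes F: "upclosed F"
    and resJ: "has_res p (vec1 ` (sf_ideal {s. s - {x} \<in> F} :: ('v, 'k::field) mpoly set))"
    and resQ: "has_res (Suc p) (vec1 ` (sf_ideal {s. insert x s \<in> F} :: ('v, 'k) mpoly set))"
  shows "has_res (Suc p) (vec1 ` (sf_ideal F :: ('v, 'k) mpoly set))"
proof -
  define J where "J = (sf_ideal {s. s - {x} \<in> F} :: ('v, 'k) mpoly set)"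
  define Q where "Q = (sf_ideal {s. insert x s \<in> F} :: ('v, 'k) mpoly set)"
  define X :: "('v, 'k) mpoly" where "X = Poly_Mapping.single (Poly_Mapping.single x 1) 1"
  have mono: "t \<in> F" if "s \<in> F" "s \<subseteq> t" for s t using F that unfolding upclosed_def by blast
  have upJ: "upclosed {s. s - {x} \<in> F}" and upQ: "upclosed {s. insert x s \<in> F}"
    unfolding upclosed_def by (auto elim!: mono)
  have JQ: "J \<subseteq> Q" unfolding J_def Q_def sf_ideal_def by (auto elim!: mono)
  have JF: "J \<subseteq> sf_ideal F" unfolding J_def sf_ideal_def by (auto elim!: mono)
  have XQ: "X * q \<in> sf_ideal F" if "q \<in> Q" for q
  proof -
    have "Poly_Mapping.keys t \<in> F" if t: "t \<in> Poly_Mapping.keys (X * q)" for t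
    proof -
      obtain b where b: "t = Poly_Mapping.single x 1 + b" "b \<in> Poly_Mapping.keys q"
        using Poly_Mapping.keys_mult[of X q] t by (auto simp: X_def)
      then show ?thesis using \<open>q \<in> Q\<close> by (auto simp: Q_def sf_ideal_def keys_plus_nat)
    qed
    then show ?thesis by (simp add: sf_ideal_def)
  qed
  have XJ: "X * q \<in> J" if "q \<in> J" for q
    using that unfolding J_def by (rule sf_ideal_mult[OF upJ])
  \<comment> \<open>Membership in \<open>J\<close> ignores \<open>x\<close>, so dividing by
    \<open>x\<close> stays inside \<open>J\<close>. This gives exactness in the middle: if x q = j
    with j in \<open>J\<close>, then q is in \<open>J\<close>.\<close>
  have Jcancel: "q \<in> J" if "X * q \<in> J" for q
  proof -
    have "Poly_Mapping.keys t - {x} \<in> F" if "t \<in> Poly_Mapping.keys q" for t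
    proof -
      have "Poly_Mapping.single x 1 + t \<in> Poly_Mapping.keys (X * q)"
        using that by (simp add: in_keys_iff X_def lookup_monomial_mult)
      then have "Poly_Mapping.keys (Poly_Mapping.single x 1 + t) - {x} \<in> F"
        using \<open>X * q \<in> J\<close> by (simp add: J_def sf_ideal_def)
      then show ?thesis by (simp add: keys_plus_nat)
    qed
    then show ?thesis by (simp add: J_def sf_ideal_def)
  qed
  \<comment> \<open>Surjectivity onto the ideal: a term divisible by \<open>x\<close> is
    \<open>X\<close> times a term of \<open>Q\<close>, and any other term already lies in
    \<open>J\<close>, up to the sign in the map.\<close>
  have split: "\<exists>q\<in>Q. \<exists>j\<in>J. r = X * q - j" if "r \<in> sf_ideal F" for r
    using that
  proof (induction rule: sf_ideal_induct)
    case zero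
    show ?case using sf_ideal_zero by (force simp: Q_def J_def)
  next
    case (add a b)
    then obtain q j q' j' where qj: "q \<in> Q" "q' \<in> Q" "j \<in> J" "j' \<in> J"
      and ab: "a = X * q - j" "b = X * q' - j'" by blast
    have "a + b = X * (q + q') - (j + j')" unfolding ab by (simp add: algebra_simps)
    with qj show ?case using sf_ideal_add unfolding J_def Q_def by blast
  next
    case (monomial t c)
    show ?case
    proof (cases "x \<in> Poly_Mapping.keys t")
      case True
      \<comment> \<open>Division by \<open>x\<close>; the truncated subtraction of exponents is
        exact because \<open>x\<close> occurs in \<open>t\<close>.\<close>
      define u where "u = t - Poly_Mapping.single x 1"
      have t: "t = Poly_Mapping.single x 1 + u"
        using True unfolding u_def
        by (intro poly_mapping_eqI) (auto simp: lookup_add lookup_minus lookup_single when_def in_keys_iff)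
      then have "insert x (Poly_Mapping.keys u) \<in> F" using monomial by (simp add: keys_plus_nat)
      then have "Poly_Mapping.single u c \<in> Q" by (simp add: Q_def sf_ideal_def)
      moreover have "Poly_Mapping.single t c = X * Poly_Mapping.single u c - 0"
        by (simp add: X_def mult_single t)
      ultimately show ?thesis using sf_ideal_zero unfolding J_def by blast
    next
      case False
      then have "Poly_Mapping.keys t - {x} \<in> F" using monomial by simp
      then have "- Poly_Mapping.single t c \<in> J"
        unfolding J_def by (intro sf_ideal_uminus) (simp add: sf_ideal_def)
      moreover have "Poly_Mapping.single t c = X * 0 - (- Poly_Mapping.single t c)" by simp
      ultimately show ?thesis using sf_ideal_zero unfolding Q_def by blast
    qed
  qed
  \<comment> \<open>The direct sum of \<open>Q\<close> and \<open>J\<close> as vectors of length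
    two. It is resolved as an extension of \<open>J\<close> by \<open>Q\<close>, after padding the
    resolution of \<open>J\<close> by one step.\<close>
  define M where "M = {v \<in> fvecs 2. v 0 \<in> Q \<and> v 1 \<in> J}"
  have "has_res (Suc p) M"
  proof (rule has_res_extension[where f = "\<lambda>v. v" and g = "vec_drop 1"])
    show "has_res (Suc p) (vec1 ` Q)" using resQ by (simp only: Q_def)
    show "has_res (Suc p) (vec1 ` J)" using has_res_Suc[OF resJ] by (simp only: J_def)
    show "submod M"
      unfolding submod_def M_def
      by (auto simp: Q_def J_def sf_ideal_zero sf_ideal_add sf_ideal_mult upQ upJ fvecs_def)
    show "linear_on M (vec_drop 1)" by (simp add: linear_on_def vec_linear)
    show "(\<lambda>v. v) ` vec1 ` Q = {m \<in> M. vec_drop 1 m = 0}"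
    proof (intro equalityI subsetI)
      fix v assume "v \<in> (\<lambda>v. v) ` vec1 ` Q"
      then show "v \<in> {m \<in> M. vec_drop 1 m = 0}"
        by (auto simp: M_def vec_drop_def fvecs_def J_def sf_ideal_zero fun_eq_iff)
    next
      fix v assume v: "v \<in> {m \<in> M. vec_drop 1 m = 0}"
      have "v i = 0" if "i > 0" for i
      proof -
        have "vec_drop 1 v (i - 1) = 0" using v by simp
        then show ?thesis using that by (simp add: vec_drop_def)
      qed
      then show "v \<in> (\<lambda>v. v) ` vec1 ` Q" using v by (simp add: vec1_image_iff M_def)
    qed
    show "vec_drop 1 ` M = vec1 ` J"
    proof (intro equalityI subsetI)
      fix v assume "v \<in> vec_drop 1 ` M"
      then show "v \<in> vec1 ` J"
        by (auto simp: M_def vec_drop_def fvecs_def vec1_image_iff)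
    next
      fix v assume v: "v \<in> vec1 ` J"
      have "vec_append 1 0 v \<in> M"
        using v by (auto simp: M_def vec_append_def fvecs_def Q_def sf_ideal_zero)
      then show "v \<in> vec_drop 1 ` M" by (rule rev_image_eqI) simp
    qed
  qed (auto simp: linear_on_def)
  then show ?thesis
  proof (rule has_res_cokernel[rotated, where M' = "vec1 ` J" and g = "\<lambda>v. vec1 (X * v 0 - v 1)"
        and f = "\<lambda>u i. if i = 0 then u 0 else if i = 1 then X * u 0 else 0"])
    let ?f = "\<lambda>(u :: nat \<Rightarrow> ('v, 'k) mpoly) (i :: nat). if i = 0 then u 0 else if i = 1 then X * u 0 else 0"
    show "has_res p (vec1 ` J)" using resJ by (simp only: J_def)
    show "linear_on (vec1 ` J) ?f"
      by (auto simp: linear_on_def fun_eq_iff algebra_simps)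
    show "inj_on ?f (vec1 ` J)"
    proof (rule inj_onI)
      fix u v assume uv: "u \<in> vec1 ` J" "v \<in> vec1 ` J" "?f u = ?f v"
      from fun_cong[OF uv(3), of 0] have "u 0 = v 0" by simp
      with uv(1,2) show "u = v" by auto
    qed
    show "linear_on M (\<lambda>v. vec1 (X * v 0 - v 1))"
      by (auto simp: linear_on_def fun_eq_iff vec1_def algebra_simps)
    show "(\<lambda>v. vec1 (X * v 0 - v 1)) ` M = vec1 ` sf_ideal F"
    proof (intro equalityI subsetI)
      fix y assume "y \<in> (\<lambda>v. vec1 (X * v 0 - v 1)) ` M"
      then show "y \<in> vec1 ` sf_ideal F" using XQ JF by (auto simp: M_def intro!: imageI sf_ideal_diff)
    next
      fix y :: "nat \<Rightarrow> ('v, 'k) mpoly" assume "y \<in> vec1 ` sf_ideal F"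
      then obtain q j where qj: "q \<in> Q" "j \<in> J" "y = vec1 (X * q - j)" using split by blast
      then have "(\<lambda>i. if i = 0 then q else if i = 1 then j else 0) \<in> M"
        by (simp add: M_def fvecs_def)
      then show "y \<in> (\<lambda>v. vec1 (X * v 0 - v 1)) ` M" 
        by (rule rev_image_eqI) (simp add: qj(3))
    qed
    show "?f ` vec1 ` J = {m \<in> M. vec1 (X * m 0 - m 1) = 0}"
    proof (intro equalityI subsetI)
      fix v assume "v \<in> ?f ` vec1 ` J"
      then show "v \<in> {m \<in> M. vec1 (X * m 0 - m 1) = 0}"
        using XJ JQ by (auto simp: M_def fvecs_def vec1_def fun_eq_iff)
    next
      fix v assume v: "v \<in> {m \<in> M. vec1 (X * m 0 - m 1) = 0}"
      have "vec1 (X * v 0 - v 1) 0 = 0" using v by simp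
      then have eq: "v 1 = X * v 0" by simp
      moreover have "v 0 \<in> J" using v eq Jcancel by (simp add: M_def)
      moreover have "v = ?f (vec1 (v 0))"
      proof
        fix i
        show "v i = ?f (vec1 (v 0)) i" using v eq by (auto simp: M_def fvecs_def)
      qed
      ultimately show "v \<in> ?f ` vec1 ` J" by blast
    qed
  qed
qed

text \<open>The unit ideal is free of rank one, so the identity is a cover with zero kernel.\<close>

lemma has_res_sf_ideal_UNIV:
  "has_res (Suc p) (vec1 ` (sf_ideal UNIV :: ('v, 'k::field) mpoly set))"
proof (rule has_res_mono[of 1])
  have "vec1 ` (sf_ideal UNIV :: ('v, 'k) mpoly set) = fvecs 1"
    by (auto simp: vec1_image_iff sf_ideal_def fvecs_def)
  moreover have "{v \<in> fvecs 1. v = 0} = {0 :: nat \<Rightarrow> ('v, 'k) mpoly}"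
    by (auto simp: fvecs_def)
  ultimately show "has_res 1 (vec1 ` (sf_ideal UNIV :: ('v, 'k) mpoly set))"
    by (auto simp: linear_on_def intro!: exI[of _ 1] exI[of _ "\<lambda>v. v"])
qed simp

text \<open>This is the ideal generated by the variables in \<open>U\<close>. Splitting along one of
  them leaves the ideal of the others and the unit ideal as colon, so each variable costs one step,
  as in the Koszul complex.\<close>

lemma has_res_variables_ideal:
  "finite U \<Longrightarrow> has_res (card U) (vec1 ` (sf_ideal {s. s \<inter> U \<noteq> {}} :: ('v, 'k::field) mpoly set))"
proof (induction U rule: finite_induct)
  case empty
  have "sf_ideal {} = {0 :: ('v, 'k) mpoly}" by (auto simp: sf_ideal_def)
  moreover have "vec1 (0 :: ('v, 'k) mpoly) = 0" by (simp add: vec1_def fun_eq_iff)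
  ultimately show ?case by (simp only: Int_empty_right simp_thms empty_def[symmetric]
        image_insert image_empty card.empty has_res.simps)
next
  case (insert x U)
  let ?F = "{s. s \<inter> insert x U \<noteq> {}}"
  have "{s. s - {x} \<in> ?F} = {s. s \<inter> U \<noteq> {}}" "{s. insert x s \<in> ?F} = UNIV"
    using insert.hyps by auto
  then have "has_res (Suc (card U)) (vec1 ` (sf_ideal ?F :: ('v, 'k) mpoly set))"
    by (intro has_res_sf_ideal_split[of ?F "card U" x])
      (simp_all only: insert.IH has_res_sf_ideal_UNIV, auto simp: upclosed_def)
  then show ?case unfolding card_insert_disjoint[OF insert.hyps] .
qed

section \<open>Edge ideals with added variables, and relaxed domination\<close>

text \<open>Supports of the monomials in the ideal generated by the variables in \<open>U\<close>
  and the edges induced on \<open>W\<close>. Taking colon ideals moves neighbours from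
  \<open>W\<close> into \<open>U\<close>.\<close>

definition edge_family :: "'v set set \<Rightarrow> 'v set \<Rightarrow> 'v set \<Rightarrow> 'v set set" where
  "edge_family E W U = {s. s \<inter> U \<noteq> {} \<or> (\<exists>a\<in>W \<inter> s. \<exists>b\<in>W \<inter> s. adj E a b)}"

text \<open>Domination inside the induced subgraph on \<open>W\<close>, where a vertex isolated in \<open>W\<close> may only be
  dominated by itself.\<close>

definition dominates :: "'v set set \<Rightarrow> 'v set \<Rightarrow> 'v set \<Rightarrow> 'v set \<Rightarrow> bool" where
  "dominates E W D B \<longleftrightarrow> D \<subseteq> W \<and> B \<subseteq> nbhd E D \<union> {a \<in> D. \<forall>b\<in>W. \<not> adj E a b}"

lemma adj_sym: "adj E x y \<longleftrightarrow> adj E y x"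
  by (auto simp: adj_def insert_commute)

lemma upclosed_edge_family: "upclosed (edge_family E W U)"
  unfolding upclosed_def edge_family_def by blast

lemma dominates_self: "dominates E W W (A \<inter> W)"
  unfolding dominates_def nbhd_def using adj_sym[of E] by blast

text \<open>A vertex isolated in \<open>W'\<close> may acquire neighbours in \<open>W\<close> and
  then no longer dominates itself. Inside \<open>B\<close> it dominated nothing else, so one of
  these neighbours can replace it.\<close>

lemma dominates_enlarge:
  fixes W :: "'v::finite set"
  assumes D: "dominates E W' D B" and "W' \<subseteq> W" "B \<subseteq> W'"
  shows "\<exists>D'. card D' \<le> card D \<and> dominates E W D' B"
proof -
  define \<phi> where "\<phi> a = (if (\<forall>b\<in>W'. \<not> adj E a b) \<and> (\<exists>b\<in>W. adj E a b)
    then SOME b. b \<in> W \<and> adj E a b else a)" for a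
  have iso: "\<phi> a \<in> W \<and> adj E a (\<phi> a)" if "\<forall>b\<in>W'. \<not> adj E a b" "\<exists>b\<in>W. adj E a b" for a
    using that someI_ex[of "\<lambda>b. b \<in> W \<and> adj E a b"] by (auto simp: \<phi>_def)
  have "\<phi> a \<in> W" if "a \<in> D" for a
    using iso[of a] that assms unfolding dominates_def by (cases "\<phi> a = a") (auto simp: \<phi>_def)
  moreover have "c \<in> nbhd E (\<phi> ` D) \<union> {a \<in> \<phi> ` D. \<forall>b\<in>W. \<not> adj E a b}" if c: "c \<in> B" for c
  proof (cases "c \<in> D \<and> (\<forall>b\<in>W'. \<not> adj E c b)")
    case True
    show ?thesis
    proof (cases "\<exists>b\<in>W. adj E c b")
      case True
      then show ?thesis using iso[of c] \<open>c \<in> D \<and> _\<close> adj_sym[of E] unfolding nbhd_def by blast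
    next
      case False
      then have "\<phi> c = c" by (auto simp: \<phi>_def)
      then have "c \<in> \<phi> ` D" using True by (metis imageI)
      then show ?thesis using False by blast
    qed
  next
    case False
    then obtain y where y: "y \<in> D" "adj E y c" using c D unfolding dominates_def nbhd_def by blast
    \<comment> \<open>Being adjacent to \<open>c\<close> in \<open>W'\<close>, the vertex
      \<open>y\<close> is not isolated there, so it is not replaced.\<close>
    then have "\<phi> y = y" using c assms(3) by (auto simp: \<phi>_def)
    then have "y \<in> \<phi> ` D" using y by (metis imageI)
    then show ?thesis using y unfolding nbhd_def by blast
  qed
  ultimately have "dominates E W (\<phi> ` D) B" unfolding dominates_def by blast
  then show ?thesis using card_image_le[of D \<phi>] by auto
qed

text \<open>Here \<open>d\<close> is any lower bound for the relaxed domination number, not its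
  exact value, so the induction on \<open>card W\<close> can pass on \<open>d\<close> after a
  deletion and \<open>d - 1\<close> after a colon.\<close>

lemma has_res_edge_family:
  fixes E :: "'v::finite set set"
  assumes A: "independent E A"
    and "W \<inter> U = {}" "\<And>D. dominates E W D (A \<inter> W) \<Longrightarrow> d \<le> card D"
  shows "has_res (card U + card W - d) (vec1 ` (sf_ideal (edge_family E W U) :: ('v, 'k::field) mpoly set))"
  using assms(2,3)
proof (induction "card W" arbitrary: W U d rule: less_induct)
  case less
  note disj = less.prems(1) and dom = less.prems(2)
  have dW: "d \<le> card W" using dom dominates_self by blast
  show ?case
  proof (cases "\<exists>a\<in>W. \<exists>b\<in>W. adj E a b")
    case False
    then have "edge_family E W U = {s. s \<inter> U \<noteq> {}}" unfolding edge_family_def by blast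
    then show ?thesis
      using dW by (simp only:) (rule has_res_mono[OF has_res_variables_ideal], simp_all)
  next
    case True
    \<comment> \<open>By independence, every edge has an endpoint outside \<open>A\<close>; deleting
      that endpoint leaves \<open>A \<inter> W\<close> unchanged.\<close>
    then obtain x y where xy: "x \<in> W" "y \<in> W" "adj E x y" "x \<notin> A"
      using A adj_sym[of E] unfolding independent_def by metis
    have xU: "x \<notin> U" using disj xy(1) by blast
    define N where "N = {z \<in> W. adj E x z}"
    have N: "N \<subseteq> W" "x \<notin> N" by (auto simp: N_def adj_def)
    define W1 where "W1 = W - {x} - N"
    define W2 where "W2 = W - {x}"
    have AW2: "A \<inter> W2 = A \<inter> W" using xy(4) by (auto simp: W2_def)
    have card2: "card W = Suc (card W2)" 
      unfolding W2_def using xy(1) by (intro card.remove) auto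
    have "card W2 = card N + card W1"
      unfolding W1_def W2_def using N by (subst card_Un_disjoint[symmetric]) (auto intro!: arg_cong[of _ _ card])
    moreover have "card (U \<union> N) = card U + card N"
      using disj N by (intro card_Un_disjoint) auto
    \<comment> \<open>The neighbours of \<open>x\<close> move from \<open>W\<close> to
      \<open>U\<close>, so the colon ideal loses only \<open>x\<close> from the total count, just as
      the deletion does.\<close>
    ultimately have card1: "card (U \<union> N) + card W1 = card U + card W2" "card W1 < card W"
      using card2 by auto
    have dom2: "d \<le> card D" if "dominates E W2 D (A \<inter> W2)" for D
    proof -
      have "\<exists>D'. card D' \<le> card D \<and> dominates E W D' (A \<inter> W2)"
        using that by (rule dominates_enlarge) (auto simp: W2_def)
      then show ?thesis using dom unfolding AW2 by (meson order_trans)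
    qed
    have res2: "has_res (card U + card W2 - d)
        (vec1 ` (sf_ideal (edge_family E W2 U) :: ('v, 'k) mpoly set))"
      using less.hyps[of W2 U d] card2 disj dom2 by (auto simp: W2_def)
    \<comment> \<open>The vertices of \<open>A \<inter> W\<close> missing from \<open>W1\<close> are
      neighbours of \<open>x\<close>, so adding \<open>x\<close> to an enlarged dominating set
      covers them at the cost of one.\<close>
    have dom1: "d - 1 \<le> card D" if D: "dominates E W1 D (A \<inter> W1)" for D
    proof -
      have "\<exists>D'. card D' \<le> card D \<and> dominates E W D' (A \<inter> W1)"
        using D by (rule dominates_enlarge) (auto simp: W1_def)
      then obtain D' where D': "card D' \<le> card D" "dominates E W D' (A \<inter> W1)" by blast
      have "A \<inter> W \<subseteq> A \<inter> W1 \<union> nbhd E {x}"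
        using xy(4) by (auto simp: W1_def N_def nbhd_def)
      then have "dominates E W (insert x D') (A \<inter> W)"
        using D'(2) xy(1) unfolding dominates_def nbhd_def by blast
      then have "d \<le> card (insert x D')" by (rule dom)
      also have "\<dots> \<le> Suc (card D')" by (rule card_insert_le_m1) auto
      finally show ?thesis using D'(1) by simp
    qed
    have res1: "has_res (card (U \<union> N) + card W1 - (d - 1))
        (vec1 ` (sf_ideal (edge_family E W1 (U \<union> N)) :: ('v, 'k) mpoly set))"
    proof (rule less.hyps)
      show "W1 \<inter> (U \<union> N) = {}" using disj by (auto simp: W1_def)
    qed (use card1 dom1 in auto)
    \<comment> \<open>This bound keeps the natural-number subtraction from truncating, so that
      \<open>Suc\<close> can be pulled out of it.\<close>
    have "d \<le> card W2" using dom2 dominates_self by blast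
    then have len: "card U + card W - d = Suc (card U + card W2 - d)" using card2 by simp
    have J: "{s. s - {x} \<in> edge_family E W U} = edge_family E W2 U"
      unfolding edge_family_def W2_def using xU by auto
    \<comment> \<open>An edge at \<open>x\<close> has its other end in \<open>N\<close>, where a
      single variable suffices; an edge meeting \<open>N\<close> is absorbed by that variable. The
      remaining edges lie in \<open>W1\<close>.\<close>
    have Q: "{s. insert x s \<in> edge_family E W U} = edge_family E W1 (U \<union> N)"
    proof (intro equalityI subsetI)
      fix s assume "s \<in> edge_family E W1 (U \<union> N)"
      then show "s \<in> {s. insert x s \<in> edge_family E W U}"
        using xy(1) unfolding edge_family_def W1_def N_def by blast
    next
      fix s assume s: "s \<in> {s. insert x s \<in> edge_family E W U}"
      show "s \<in> edge_family E W1 (U \<union> N)"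
      proof (cases "s \<inter> (U \<union> N) = {}")
        case True
        then obtain a b where ab: "a \<in> W" "b \<in> W" "a \<in> insert x s" "b \<in> insert x s" "adj E a b"
          using s xU unfolding edge_family_def by blast
        have "a \<noteq> x" "b \<noteq> x" using ab True N(2) adj_sym[of E a b] unfolding N_def by (auto simp: adj_def)
        then show ?thesis using ab True unfolding edge_family_def W1_def by blast
      qed (simp add: edge_family_def)
    qed
    have "has_res (Suc (card U + card W2 - d))
        (vec1 ` (sf_ideal (edge_family E W U) :: ('v, 'k) mpoly set))"
    proof (rule has_res_sf_ideal_split[where x = x])
      show "has_res (Suc (card U + card W2 - d))
          (vec1 ` (sf_ideal {s. insert x s \<in> edge_family E W U} :: ('v, 'k) mpoly set))"
        unfolding Q by (rule has_res_mono[OF res1]) (use card1 in auto)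
    qed (use res2 in \<open>simp_all only: J upclosed_edge_family\<close>)
    then show ?thesis by (simp only: len)
  qed
qed

text \<open>A monomial is divisible by an edge monomial exactly when its support contains that
  edge.\<close>

lemma edge_ideal_eq_sf_ideal:
  fixes E :: "'v::finite set set"
  assumes "simple_graph E"
  shows "(edge_ideal E :: ('v, 'k::field) mpoly set) = sf_ideal (edge_family E UNIV {})"
proof (intro equalityI subsetI)
  define m :: "'v set \<Rightarrow> 'v \<Rightarrow>\<^sub>0 nat" where "m e = (\<Sum>w\<in>e. Poly_Mapping.single w 1)" for e
  have lookup_m: "Poly_Mapping.lookup (m e) w = (if w \<in> e then 1 else 0)" for e w
    by (simp add: m_def lookup_sum lookup_single when_def)
  have keys_m: "Poly_Mapping.keys (m e) = e" for e
    by (auto simp: in_keys_iff lookup_m split: if_splits)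
  have em: "edge_monomial e = (Poly_Mapping.single (m e) 1 :: ('v, 'k) mpoly)" for e
    by (simp add: edge_monomial_def m_def)
  {
    fix p :: "('v, 'k) mpoly" assume "p \<in> edge_ideal E"
    then obtain c where p: "p = (\<Sum>e\<in>E. c e * edge_monomial e)" unfolding edge_ideal_def by blast
    have "edge_monomial e \<in> (sf_ideal (edge_family E UNIV {}) :: ('v, 'k) mpoly set)" if "e \<in> E" for e
    proof -
      obtain x y where "x \<noteq> y" "e = {x, y}" using assms \<open>e \<in> E\<close> unfolding simple_graph_def by blast
      then have "e \<in> edge_family E UNIV {}" using that by (auto simp: edge_family_def adj_def)
      then show ?thesis by (simp add: em sf_ideal_def keys_m)
    qed
    then show "p \<in> sf_ideal (edge_family E UNIV {})"
      unfolding p by (intro sf_ideal_sum sf_ideal_mult upclosed_edge_family) auto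
  next
    fix p :: "('v, 'k) mpoly" assume "p \<in> sf_ideal (edge_family E UNIV {})"
    then show "p \<in> edge_ideal E"
    proof (induction rule: sf_ideal_induct)
      case zero
      show ?case unfolding edge_ideal_def by (auto intro!: exI[of _ "\<lambda>_. 0"])
    next
      case (add a b)
      then obtain c c' where "a = (\<Sum>e\<in>E. c e * edge_monomial e)" "b = (\<Sum>e\<in>E. c' e * edge_monomial e)"
        unfolding edge_ideal_def by blast
      then have "a + b = (\<Sum>e\<in>E. (c e + c' e) * edge_monomial e)"
        by (simp add: distrib_right sum.distrib)
      then show ?case unfolding edge_ideal_def by (auto intro!: exI[of _ "\<lambda>e. c e + c' e"])
    next
      case (monomial t k)
      then obtain x y where xy: "x \<in> Poly_Mapping.keys t" "y \<in> Poly_Mapping.keys t" "{x, y} \<in> E"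
        by (auto simp: edge_family_def adj_def)
      have "(t - m {x, y}) + m {x, y} = t"
        using xy by (intro poly_mapping_eqI) (auto simp: lookup_add lookup_minus lookup_m in_keys_iff)
      then have eq: "Poly_Mapping.single t k = Poly_Mapping.single (t - m {x, y}) k * edge_monomial {x, y}"
        by (simp add: em mult_single)
      \<comment> \<open>All of the term is charged to the single edge found in its support.\<close>
      define c where "c e = (if e = {x, y} then Poly_Mapping.single (t - m {x, y}) k else 0)" for e
      have "(\<Sum>e\<in>E. c e * edge_monomial e) = (\<Sum>e\<in>E. if e = {x, y} then c e * edge_monomial e else 0)"
        by (intro sum.cong) (auto simp: c_def)
      also have "\<dots> = Poly_Mapping.single t k" using xy(3) eq by (simp add: sum.delta' c_def)
      finally show ?case unfolding edge_ideal_def by (auto intro!: exI[of _ c])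
    qed
  }
qed

section \<open>Domination numbers of the whole graph and the final bound\<close>

lemma gamma0_le:
  fixes E :: "'v::finite set set"
  assumes "X \<subseteq> nbhd E D"
  shows "gamma0 E X \<le> card D"
  unfolding gamma0_def
proof (rule Min_le)
  have "{card A | A. finite A \<and> X \<subseteq> nbhd E A} \<subseteq> card ` (UNIV :: 'v set set)" by blast
  then show "finite {card A | A. finite A \<and> X \<subseteq> nbhd E A}" by (rule finite_subset) simp
qed (use assms in auto)

lemma tau_attained:
  fixes E :: "'v::finite set set"
  obtains A where "independent E A" "tau E = gamma0 E A"
proof -
  have "{gamma0 E A | A. independent E A} \<subseteq> gamma0 E ` UNIV" by blast
  then have "finite {gamma0 E A | A. independent E A}" by (rule finite_subset) simp
  moreover have "independent E {}" by (simp add: independent_def)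
  ultimately have "tau E \<in> {gamma0 E A | A. independent E A}"
    unfolding tau_def by (intro Max_in) auto
  then show ?thesis using that by blast
qed

theorem theorem4p4:
  fixes E :: "'v::finite set set"
  assumes "simple_graph E"
    and "no_isolated E"
  shows "pd_graph TYPE('k::field) E \<le> enat (card (UNIV :: 'v set) - tau E)"
proof -
  obtain A where A: "independent E A" "tau E = gamma0 E A" by (rule tau_attained)
  define p where "p = card (UNIV :: 'v set) - tau E"
  define I :: "('v, 'k) mpoly set" where "I = edge_ideal E"
  \<comment> \<open>Without isolated vertices no vertex may dominate itself, so on the whole vertex
    set relaxed domination is ordinary domination.\<close>
  have "tau E \<le> card D" if "dominates E UNIV D (A \<inter> UNIV)" for D
  proof -
    have "A \<subseteq> nbhd E D" using that assms(2) unfolding dominates_def no_isolated_def by blast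
    then show ?thesis unfolding A(2) by (rule gamma0_le)
  qed
  then have "has_res p (vec1 ` I)"
    using has_res_edge_family[OF A(1), of UNIV "{}" "tau E"]
    by (simp add: p_def I_def edge_ideal_eq_sf_ideal[OF assms(1)])
  moreover have "vec1 ` I \<subseteq> fvecs 1" by (auto simp: fvecs_def)
  ultimately obtain r d where rd: "r 0 = 1" "r (Suc p) = 0"
    "mat_image (r 1) (r 0) (d 1) = vec1 ` I"
    "\<forall>i\<in>{1..p}. mat_kernel (r i) (r (i - 1)) (d i) = mat_image (r (Suc i)) (r i) (d (Suc i))"
    using has_res_free_resolution[of p "vec1 ` I" 1] by blast
  have "(\<lambda>v. v 0) ` vec1 ` I = I" by (simp add: image_image)
  then have "free_resolution I p r d" unfolding free_resolution_def using rd by simp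
  then have "proj_dim_quot I \<le> enat p" unfolding proj_dim_quot_def by (intro Inf_lower) blast
  then show ?thesis by (simp add: pd_graph_def I_def p_def)
qed

end
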